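(* Let $G$ be a digraph with no multiple edges on a vertex set $V$ of cardinality $n$, and let $<$ be a linear order on $V$. Let $I_{<}$ be the ideal of the algebra of walks $\mathbb{Q}\langle G\rangle$ generated by all monomials $x_{v_0,v_1}x_{v_1,v_2}$ (where $v_0\to v_1\to v_2$ is a walk in $G$) for which there is a vertex $v_1'<v_1$ such that $v_0\to v_1'\to v_2$ is a walk in $G$. Let $Z=(z_{u,v})_{u,v\in V}$ be the $n\times n$ matrix with $z_{u,v}=x_{u,v}$ if $(u,v)$ is an edge of $G$ and $z_{u,v}=0$ otherwise. If, over the ring $\mathbb{Q}\langle G\rangle/I_{<}$, every entry in every power $Z^k$ ($k\ge 1$) is a single monomial or zero, then $<$ is a vertex shelling order.
   Context: Digraphs are finite and may have loops. Algebra of walks: for a digraph $G$ with edge set $E\subseteq V\times V$, $\mathbb{Q}\langle G\rangle$ is the quotient of the free non-commutative (unital) $\mathbb{Q}$-algebra generated by the variables $\{x_{u,v}: (u,v)\in E\}$ by the two-sided ideal generated by the monomials $\{x_{u_1,v_1}x_{u_2,v_2}: v_1\ne u_2\}$. A vector space basis of $\mathbb{Q}\langle G\rangle$ is given by $1$ and all monomials $x_{v_0,v_1}x_{v_1,v_2}\cdots x_{v_{k-1},v_k}$ such that $v_0\to v_1\to\cdots\to v_k$ is a walk in $G$. "A single monomial" in the quotient means the class of one such walk monomial. Vertex shelling order: a linear order $<$ on $V$ such that for any $u,v\in V$ and every pair of walks $u=v_0\to v_1\to\cdots\to v_k=v$ and $u=v_0'\to v_1'\to\cdots\to v_k'=v$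 in $G$ of the same length with $v_1'<v_1$, there are a $j\in\{1,\dots,k-1\}$ and a vertex $w\in V$ such that $w<v_j$ and both $v_{j-1}\to w$ and $w\to v_{j+1}$ are edges of $G$. *)

theory Defs
  imports
    "HOL-Library.Poly_Mapping"
    "Graph_Theory.Graph_Theory"
    "HOL-Algebra.QuotRing"
begin

text \<open>Words form a monoid under concatenation; the class instance makes the convolution
  product on \<^typ>\<open>'x list \<Rightarrow>\<^sub>0 rat\<close> the multiplication of non-commutative polynomials.\<close>

instantiation list :: (type) monoid_add
begin

definition zero_list :: "'a list" where "zero_list = []"
definition plus_list :: "'a list \<Rightarrow> 'a list \<Rightarrow> 'a list" where "plus_list = (@)"

instance by standard (simp_all add: zero_list_def plus_list_def)

end

definition free_algebra :: "'x set \<Rightarrow> ('x list \<Rightarrow>\<^sub>0 rat) ring" where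
  "free_algebra X = \<lparr>carrier = {p. Poly_Mapping.keys p \<subseteq> lists X},
     mult = (*), one = 1, zero = 0, add = (+)\<rparr>"

lemma ring_free_algebra: "ring (free_algebra X)"
proof (rule ringI)
  show "abelian_group (free_algebra X)"
  proof (rule abelian_groupI)
    fix x y assume "x \<in> carrier (free_algebra X)" "y \<in> carrier (free_algebra X)"
    then show "x \<oplus>\<^bsub>free_algebra X\<^esub> y \<in> carrier (free_algebra X)"
      using Poly_Mapping.keys_add[of x y] by (auto simp: free_algebra_def)
  next
    fix x assume "x \<in> carrier (free_algebra X)"
    then show "\<exists>y\<in>carrier (free_algebra X). y \<oplus>\<^bsub>free_algebra X\<^esub> x = \<zero>\<^bsub>free_algebra X\<^esub>"
      by (intro bexI[of _ "- x"]) (auto simp: free_algebra_def)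
  qed (auto simp: free_algebra_def algebra_simps)
  show "Group.monoid (free_algebra X)"
  proof (rule monoidI)
    fix x y assume "x \<in> carrier (free_algebra X)" "y \<in> carrier (free_algebra X)"
    then show "x \<otimes>\<^bsub>free_algebra X\<^esub> y \<in> carrier (free_algebra X)"
      using Poly_Mapping.keys_mult[of x y]
      by (fastforce simp: free_algebra_def plus_list_def)
  qed (auto simp: free_algebra_def algebra_simps zero_list_def)
qed (auto simp: free_algebra_def algebra_simps)

text \<open>The variable \<open>x\<^bsub>u,v\<^esub>\<close> is the one-letter word on the arc \<open>(u, v)\<close>. Ideals generated in
  these rings are two-sided, and they are subspaces because the rings contain the rationals.\<close>

definition noncomposable_monomials :: "'v pair_pre_digraph \<Rightarrow> (('v \<times> 'v) list \<Rightarrow>\<^sub>0 rat) set" where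
  "noncomposable_monomials G =
     {Poly_Mapping.single [(u1, v1), (u2, v2)] 1 | u1 v1 u2 v2.
        (u1, v1) \<in> parcs G \<and> (u2, v2) \<in> parcs G \<and> v1 \<noteq> u2}"

definition walk_ideal :: "'v pair_pre_digraph \<Rightarrow> (('v \<times> 'v) list \<Rightarrow>\<^sub>0 rat) set" where
  "walk_ideal G = Idl\<^bsub>free_algebra (parcs G)\<^esub> (noncomposable_monomials G)"

definition walk_algebra :: "'v pair_pre_digraph \<Rightarrow> (('v \<times> 'v) list \<Rightarrow>\<^sub>0 rat) set ring" where
  "walk_algebra G = free_algebra (parcs G) Quot walk_ideal G"

text \<open>For a walk \<open>p = [v\<^sub>0, \<dots>, v\<^sub>k]\<close> this is the class of
  \<open>x\<^bsub>v\<^sub>0,v\<^sub>1\<^esub> \<cdots> x\<^bsub>v\<^sub>k\<^sub>-\<^sub>1,v\<^sub>k\<^esub>\<close> in the algebra of walks.\<close>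

definition walk_monomial ::
  "'v pair_pre_digraph \<Rightarrow> 'v list \<Rightarrow> (('v \<times> 'v) list \<Rightarrow>\<^sub>0 rat) set" where
  "walk_monomial G p =
     walk_ideal G +>\<^bsub>free_algebra (parcs G)\<^esub> Poly_Mapping.single (vwalk_arcs p) 1"

text \<open>An order on the vertex set is a reflexive relation \<open>r\<close> (as in \<^const>\<open>linear_order_on\<close>),
  so \<open>u < v\<close> reads \<open>(u, v) \<in> r - Id\<close>.\<close>

definition order_ideal ::
  "'v pair_pre_digraph \<Rightarrow> 'v rel \<Rightarrow> (('v \<times> 'v) list \<Rightarrow>\<^sub>0 rat) set set" where
  "order_ideal G r = Idl\<^bsub>walk_algebra G\<^esub>
     {walk_monomial G [v0, v1, v2] | v0 v1 v2. vwalk [v0, v1, v2] (with_proj G) \<and>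
        (\<exists>v1'. (v1', v1) \<in> r - Id \<and> vwalk [v0, v1', v2] (with_proj G))}"

definition order_quotient ::
  "'v pair_pre_digraph \<Rightarrow> 'v rel \<Rightarrow> (('v \<times> 'v) list \<Rightarrow>\<^sub>0 rat) set set ring" where
  "order_quotient G r = walk_algebra G Quot order_ideal G r"

definition order_quotient_monomial ::
  "'v pair_pre_digraph \<Rightarrow> 'v rel \<Rightarrow> 'v list \<Rightarrow> (('v \<times> 'v) list \<Rightarrow>\<^sub>0 rat) set set" where
  "order_quotient_monomial G r p = order_ideal G r +>\<^bsub>walk_algebra G\<^esub> walk_monomial G p"

definition single_monomial ::
  "'v pair_pre_digraph \<Rightarrow> 'v rel \<Rightarrow> (('v \<times> 'v) list \<Rightarrow>\<^sub>0 rat) set set \<Rightarrow> bool" where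
  "single_monomial G r a \<longleftrightarrow>
     (\<exists>p. vwalk p (with_proj G) \<and> vwalk_length p \<ge> 1 \<and> a = order_quotient_monomial G r p)"

lemma ring_walk_algebra:
  "ideal (walk_ideal G) (free_algebra (parcs G))" "ring (walk_algebra G)"
proof -
  interpret ring "free_algebra (parcs G)" by (rule ring_free_algebra)
  show *: "ideal (walk_ideal G) (free_algebra (parcs G))"
    unfolding walk_ideal_def
    by (rule genideal_ideal) (auto simp: noncomposable_monomials_def free_algebra_def)
  show "ring (walk_algebra G)"
    unfolding walk_algebra_def by (rule ideal.quotient_is_ring[OF *])
qed

lemma walk_monomial_carrier:
  assumes "vwalk p (with_proj G)"
  shows "walk_monomial G p \<in> carrier (walk_algebra G)"
proof -
  have "Poly_Mapping.single (vwalk_arcs p) 1 \<in> carrier (free_algebra (parcs G))"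
    using assms by (auto simp: vwalk_def free_algebra_def)
  then show ?thesis
    by (auto simp: walk_monomial_def walk_algebra_def FactRing_def A_RCOSETS_defs a_r_coset_def)
qed

lemma ring_order_quotient:
  "ideal (order_ideal G r) (walk_algebra G)" "ring (order_quotient G r)"
proof -
  interpret ring "walk_algebra G" by (rule ring_walk_algebra)
  show *: "ideal (order_ideal G r) (walk_algebra G)"
    unfolding order_ideal_def by (rule genideal_ideal) (auto intro: walk_monomial_carrier)
  show "ring (order_quotient G r)"
    unfolding order_quotient_def by (rule ideal.quotient_is_ring[OF *])
qed


text \<open>A matrix is a function on pairs of indices; only its values on \<open>V \<times> V\<close> matter, since products
  sum over \<open>V\<close> only.\<close>

definition matrix_one :: "('a, 'm) ring_scheme \<Rightarrow> 'v \<Rightarrow> 'v \<Rightarrow> 'a" where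
  "matrix_one R = (\<lambda>u v. if u = v then \<one>\<^bsub>R\<^esub> else \<zero>\<^bsub>R\<^esub>)"

definition matrix_times ::
  "('a, 'm) ring_scheme \<Rightarrow> 'v set \<Rightarrow> ('v \<Rightarrow> 'v \<Rightarrow> 'a) \<Rightarrow> ('v \<Rightarrow> 'v \<Rightarrow> 'a) \<Rightarrow> 'v \<Rightarrow> 'v \<Rightarrow> 'a" where
  "matrix_times R V A B = (\<lambda>u v. \<Oplus>\<^bsub>R\<^esub>w\<in>V. A u w \<otimes>\<^bsub>R\<^esub> B w v)"

primrec matrix_power ::
  "('a, 'm) ring_scheme \<Rightarrow> 'v set \<Rightarrow> ('v \<Rightarrow> 'v \<Rightarrow> 'a) \<Rightarrow> nat \<Rightarrow> 'v \<Rightarrow> 'v \<Rightarrow> 'a" where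
  "matrix_power R V A 0 = matrix_one R"
| "matrix_power R V A (Suc k) = matrix_times R V (matrix_power R V A k) A"

definition walk_matrix ::
  "'v pair_pre_digraph \<Rightarrow> 'v rel \<Rightarrow> 'v \<Rightarrow> 'v \<Rightarrow> (('v \<times> 'v) list \<Rightarrow>\<^sub>0 rat) set set" where
  "walk_matrix G r u v =
     (if (u, v) \<in> parcs G then order_quotient_monomial G r [u, v] else \<zero>\<^bsub>order_quotient G r\<^esub>)"

text \<open>A walk \<open>v\<^sub>0 \<rightarrow> \<cdots> \<rightarrow> v\<^sub>k\<close> is the list \<open>p\<close> with \<open>p ! i = v\<^sub>i\<close> and \<open>vwalk_length p = k\<close>.
  The condition \<open>k \<ge> 1\<close> ensures that the entries \<open>p ! 1\<close> and \<open>q ! 1\<close> exist.\<close>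

definition vertex_shelling_order :: "'v pair_pre_digraph \<Rightarrow> 'v rel \<Rightarrow> bool" where
  "vertex_shelling_order G r \<longleftrightarrow> linear_order_on (pverts G) r \<and>
     (\<forall>p q k. vwalk p (with_proj G) \<and> vwalk q (with_proj G) \<and>
        vwalk_length p = k \<and> vwalk_length q = k \<and> k \<ge> 1 \<and>
        hd p = hd q \<and> last p = last q \<and> (q ! 1, p ! 1) \<in> r - Id \<longrightarrow>
        (\<exists>j\<in>{1..k - 1}. \<exists>w\<in>pverts G. (w, p ! j) \<in> r - Id \<and>
           (p ! (j - 1), w) \<in> parcs G \<and> (w, p ! (j + 1)) \<in> parcs G))"

end

theory Submission
  imports Defs "HOL-Algebra.UnivPoly"
begin

text \<open>Call a walk reduced if no interior vertex can be exchanged for a smaller one. The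
  noncommutative polynomials none of whose words are reduced walks form an ideal containing all
  relations, so distinct reduced walks remain linearly independent in the quotient. There the
  \<open>(u, v)\<close> entry of \<open>Z\<^sup>k\<close> is the sum of the walks of length \<open>k\<close> from \<open>u\<close> to \<open>v\<close>; as it is a
  single monomial or zero, at most one of them is reduced. The lexicographically least walk is
  always reduced, hence a walk that is not lexicographically least is not.\<close>

section \<open>Monomial ideals of the free algebra\<close>

lemma free_algebra_simps [simp]:
  "p \<in> carrier (free_algebra X) \<longleftrightarrow> Poly_Mapping.keys p \<subseteq> lists X"
  "x \<otimes>\<^bsub>free_algebra X\<^esub> y = x * y" "\<one>\<^bsub>free_algebra X\<^esub> = 1"
  "x \<oplus>\<^bsub>free_algebra X\<^esub> y = x + y" "\<zero>\<^bsub>free_algebra X\<^esub> = 0"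
  by (simp_all add: free_algebra_def)

lemma free_algebra_uminus:
  assumes "x \<in> carrier (free_algebra X)"
  shows "\<ominus>\<^bsub>free_algebra X\<^esub> x = - x"
proof -
  interpret ring "free_algebra X" by (rule ring_free_algebra)
  show ?thesis
    by (rule minus_equality) (use assms in simp_all)
qed

lemma free_algebra_minus:
  assumes "y \<in> carrier (free_algebra X)"
  shows "x \<ominus>\<^bsub>free_algebra X\<^esub> y = x - y"
  using assms by (simp add: a_minus_def free_algebra_uminus del: free_algebra_simps(1))

lemma finsum_free_algebra:
  assumes "finite A" "f \<in> A \<rightarrow> carrier (free_algebra X)"
  shows "finsum (free_algebra X) f A = sum f A"
proof -
  interpret ring "free_algebra X" by (rule ring_free_algebra)
  show ?thesis
    using assms by (induction A rule: finite_induct) (simp_all add: Pi_def)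
qed

text \<open>Every word of a product is a concatenation of a word of each factor. As \<open>P\<close>
  passes to both parts of a concatenation, one part failing \<open>P\<close> spoils the whole word,
  so polynomials with no word in \<open>P\<close> absorb multiplication on either side. This
  supplies the ideal of polynomials without reduced words.\<close>

lemma ideal_avoiding_words:
  assumes "\<And>x y. P (x @ y) \<Longrightarrow> P x \<and> P y"
  shows "ideal {f \<in> carrier (free_algebra X). \<forall>x. P x \<longrightarrow> Poly_Mapping.lookup f x = 0} (free_algebra X)"
    (is "ideal ?K _")
proof -
  interpret ring "free_algebra X" by (rule ring_free_algebra)
  have K_iff: "f \<in> ?K \<longleftrightarrow> Poly_Mapping.keys f \<subseteq> {x \<in> lists X. \<not> P x}" for f
    by (auto simp: in_keys_iff)
  have mult: "a * b \<in> ?K" if "Poly_Mapping.keys a \<subseteq> A" "Poly_Mapping.keys b \<subseteq> B"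
    and "\<And>x y. x \<in> A \<Longrightarrow> y \<in> B \<Longrightarrow> x @ y \<in> {x \<in> lists X. \<not> P x}" for a b A B
    unfolding K_iff using keys_mult[of a b] that unfolding plus_list_def by blast
  show ?thesis
  proof (rule idealI[OF ring_axioms])
    show "subgroup ?K (add_monoid (free_algebra X))"
    proof (rule add.subgroupI)
      show "\<ominus>\<^bsub>free_algebra X\<^esub> a \<in> ?K" if "a \<in> ?K" for a
        using that free_algebra_uminus[of a X] by simp
    next
      show "a \<oplus>\<^bsub>free_algebra X\<^esub> b \<in> ?K" if "a \<in> ?K" "b \<in> ?K" for a b
        using that order_trans[OF keys_add[of a b], of "lists X"] by (simp add: lookup_add)
    qed (auto intro!: exI[of _ 0])
  next
    fix a x assume "a \<in> ?K" and "x \<in> carrier (free_algebra X)"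
    then have a: "Poly_Mapping.keys a \<subseteq> {x \<in> lists X. \<not> P x}" and x: "Poly_Mapping.keys x \<subseteq> lists X"
      unfolding K_iff by simp_all
    have words: "y @ z \<in> {x \<in> lists X. \<not> P x}"
      if "y \<in> lists X" "z \<in> lists X" "\<not> P y \<or> \<not> P z" for y z
      using that assms[of y z] by force
    show "x \<otimes>\<^bsub>free_algebra X\<^esub> a \<in> ?K"
      unfolding free_algebra_simps(2) by (rule mult[OF x a]) (rule words; blast)
    show "a \<otimes>\<^bsub>free_algebra X\<^esub> x \<in> ?K"
      unfolding free_algebra_simps(2) by (rule mult[OF a x]) (rule words; blast)
  qed
qed

text \<open>Appending a fixed letter is injective on words, so at most one term of the convolution
  survives. This reads coefficients off the recursion for the powers of \<open>Z\<close>.\<close>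

lemma lookup_times_single_append:
  fixes f :: "'x list \<Rightarrow>\<^sub>0 rat"
  shows "Poly_Mapping.lookup (f * Poly_Mapping.single [a] 1) (x @ [b])
    = (if a = b then Poly_Mapping.lookup f x else 0)"
proof -
  have inner: "(\<Sum>q. Poly_Mapping.lookup (Poly_Mapping.single [a] (1::rat)) q when x @ [b] = l + q)
      = (1 when x @ [b] = l @ [a])" for l
  proof -
    have "(\<lambda>q. Poly_Mapping.lookup (Poly_Mapping.single [a] (1::rat)) q when x @ [b] = l + q)
        = (\<lambda>q. (1 when x @ [b] = l @ [a]) when q = [a])"
      by (auto simp: lookup_single when_def plus_list_def fun_eq_iff)
    then show ?thesis by (simp only: Sum_any_when_equal)
  qed
  have "(\<lambda>l. Poly_Mapping.lookup f l * (1 when x @ [b] = l @ [a]))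
      = (\<lambda>l. (Poly_Mapping.lookup f x when a = b) when l = x)"
    by (auto simp: when_def fun_eq_iff)
  then have "Poly_Mapping.lookup (f * Poly_Mapping.single [a] 1) (x @ [b])
      = (\<Sum>l. ((Poly_Mapping.lookup f x when a = b) when l = x))"
    by (simp only: lookup_mult inner)
  then show ?thesis
    by (simp add: when_def)
qed

section \<open>The order quotient\<close>

text \<open>Phrasing reducedness on neighbouring arcs turns it into a \<open>successively\<close>
  condition on words, which both parts of a concatenation inherit. The first conjunct excludes the
  generators of \<open>walk_ideal\<close>, the second those of \<open>order_ideal\<close>.\<close>

definition reduced_step :: "'v pair_pre_digraph \<Rightarrow> 'v rel \<Rightarrow> 'v \<times> 'v \<Rightarrow> 'v \<times> 'v \<Rightarrow> bool" where
  "reduced_step G r a b \<longleftrightarrow> snd a = fst b \<and>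
     (\<nexists>w. (w, snd a) \<in> r - Id \<and> (fst a, w) \<in> parcs G \<and> (w, snd b) \<in> parcs G)"

definition order_proj ::
  "'v pair_pre_digraph \<Rightarrow> 'v rel \<Rightarrow> (('v \<times> 'v) list \<Rightarrow>\<^sub>0 rat) \<Rightarrow> (('v \<times> 'v) list \<Rightarrow>\<^sub>0 rat) set set" where
  "order_proj G r f =
     order_ideal G r +>\<^bsub>walk_algebra G\<^esub> (walk_ideal G +>\<^bsub>free_algebra (parcs G)\<^esub> f)"

lemma order_quotient_monomial_eq_proj:
  "order_quotient_monomial G r p = order_proj G r (Poly_Mapping.single (vwalk_arcs p) 1)"
  by (simp add: order_quotient_monomial_def order_proj_def walk_monomial_def)

lemma order_proj_hom: "ring_hom_ring (free_algebra (parcs G)) (order_quotient G r) (order_proj G r)"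
proof (rule ring_hom_ringI2[OF ring_free_algebra ring_order_quotient(2)])
  show "order_proj G r \<in> ring_hom (free_algebra (parcs G)) (order_quotient G r)"
    using ring_hom_trans[OF ideal.rcos_ring_hom[OF ring_walk_algebra(1)[of G], folded walk_algebra_def]
        ideal.rcos_ring_hom[OF ring_order_quotient(1)[of G r]]]
    by (simp add: order_quotient_def order_proj_def[abs_def] comp_def)
qed

text \<open>Each relation, of either kind, is represented by a two-letter word that is not reduced,
  so the kernel of \<open>order_proj\<close> lies in the ideal \<open>K\<close> of polynomials
  without reduced words. Coefficients of reduced words are therefore invariants of the
  class.\<close>

lemma order_proj_eqD:
  assumes f: "f \<in> carrier (free_algebra (parcs G))" and g: "g \<in> carrier (free_algebra (parcs G))"
    and eq: "order_proj G r f = order_proj G r g"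
    and x: "successively (reduced_step G r) x"
  shows "Poly_Mapping.lookup f x = Poly_Mapping.lookup g x"
proof -
  let ?A = "free_algebra (parcs G)" and ?W = "walk_ideal G" and ?O = "order_ideal G r"
  define K where "K = {f \<in> carrier ?A. \<forall>x. successively (reduced_step G r) x \<longrightarrow> Poly_Mapping.lookup f x = 0}"
  interpret A: ring ?A by (rule ring_free_algebra)
  interpret W: ring "walk_algebra G" by (rule ring_walk_algebra)
  interpret K: ideal K ?A
    unfolding K_def by (rule ideal_avoiding_words) (simp add: successively_append_iff)
  interpret h: ring_hom_ring ?A "walk_algebra G" "(+>\<^bsub>?A\<^esub>) ?W"
    unfolding walk_algebra_def by (rule ideal.rcos_ring_hom_ring[OF ring_walk_algebra(1)])
  have WK: "?W \<subseteq> K"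
    unfolding walk_ideal_def
    by (rule A.genideal_minimal[OF K.is_ideal])
      (auto simp: noncomposable_monomials_def K_def lookup_single when_def reduced_step_def)
  \<comment> \<open>The order ideal lives in the first quotient, so it is compared with the image of
    \<open>K\<close> there, again an ideal.\<close>
  have OK: "?O \<subseteq> (+>\<^bsub>?A\<^esub>) ?W ` K"
    unfolding order_ideal_def
  proof (rule W.genideal_minimal)
    show "ideal ((+>\<^bsub>?A\<^esub>) ?W ` K) (walk_algebra G)"
      unfolding walk_algebra_def
      by (rule A.ring_ideal_imp_quot_ideal[OF ring_walk_algebra(1) K.is_ideal])
    have "Poly_Mapping.single (vwalk_arcs [v0, v1, v2]) 1 \<in> K"
      if "vwalk [v0, v1, v2] (with_proj G)" "(v1', v1) \<in> r - Id" "vwalk [v0, v1', v2] (with_proj G)"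
      for v0 v1 v1' v2
      using that by (auto simp: K_def lookup_single when_def reduced_step_def vwalk_def)
    then show "{walk_monomial G [v0, v1, v2] | v0 v1 v2. vwalk [v0, v1, v2] (with_proj G) \<and>
        (\<exists>v1'. (v1', v1) \<in> r - Id \<and> vwalk [v0, v1', v2] (with_proj G))} \<subseteq> (+>\<^bsub>?A\<^esub>) ?W ` K"
      unfolding walk_monomial_def by blast
  qed
  have "(?W +>\<^bsub>?A\<^esub> f) \<ominus>\<^bsub>walk_algebra G\<^esub> (?W +>\<^bsub>?A\<^esub> g) \<in> ?O"
    using eq W.quotient_eq_iff_same_a_r_cos[OF ring_order_quotient(1) h.hom_closed[OF f] h.hom_closed[OF g]]
    by (simp add: order_proj_def)
  moreover have "?W +>\<^bsub>?A\<^esub> (f \<ominus>\<^bsub>?A\<^esub> g) = (?W +>\<^bsub>?A\<^esub> f) \<ominus>\<^bsub>walk_algebra G\<^esub> (?W +>\<^bsub>?A\<^esub> g)"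
    unfolding a_minus_def h.hom_add[OF f A.a_inv_closed[OF g]] h.hom_a_inv[OF g] ..
  ultimately obtain k where k: "k \<in> K" "?W +>\<^bsub>?A\<^esub> (f \<ominus>\<^bsub>?A\<^esub> g) = ?W +>\<^bsub>?A\<^esub> k"
    using OK by auto
  \<comment> \<open>Here \<open>f - g\<close> and \<open>k\<close> represent the same class, so they
    differ by an element of \<open>walk_ideal\<close>, hence of \<open>K\<close>. Thus
    \<open>f - g\<close> itself lies in \<open>K\<close>.\<close>
  have "(f \<ominus>\<^bsub>?A\<^esub> g) \<ominus>\<^bsub>?A\<^esub> k \<in> ?W"
    using A.quotient_eq_iff_same_a_r_cos[OF ring_walk_algebra(1) A.minus_closed[OF f g] K.Icarr[OF k(1)]] k(2)
    by simp
  then have "f - g - k \<in> K"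
    using WK free_algebra_minus[OF g] free_algebra_minus[OF K.Icarr[OF k(1)]] by auto
  with k(1) x show ?thesis
    by (auto simp: K_def lookup_minus)
qed

section \<open>Powers of the walk matrix\<close>

text \<open>A representative in the free algebra of an entry of a power of \<open>Z\<close>; unlike
  the entry itself, it has coefficients that can be looked up.\<close>

primrec walk_sum :: "'v pair_pre_digraph \<Rightarrow> nat \<Rightarrow> 'v \<Rightarrow> 'v \<Rightarrow> ('v \<times> 'v) list \<Rightarrow>\<^sub>0 rat" where
  "walk_sum G 0 = (\<lambda>u v. if u = v then 1 else 0)"
| "walk_sum G (Suc k) = (\<lambda>u v. \<Sum>w\<in>pverts G.
     walk_sum G k u w * (if (w, v) \<in> parcs G then Poly_Mapping.single [(w, v)] 1 else 0))"

lemma walk_sum_carrier: "walk_sum G k u v \<in> carrier (free_algebra (parcs G))"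
proof (induction k arbitrary: v)
  case 0
  then show ?case by (simp add: zero_list_def)
next
  case (Suc k)
  interpret ring "free_algebra (parcs G)" by (rule ring_free_algebra)
  let ?f = "\<lambda>w. walk_sum G k u w * (if (w, v) \<in> parcs G then Poly_Mapping.single [(w, v)] 1 else 0)"
  have f: "?f w \<in> carrier (free_algebra (parcs G))" for w
    using m_closed[OF Suc.IH[of w], of "if (w, v) \<in> parcs G then Poly_Mapping.single [(w, v)] 1 else 0"]
    by simp
  show ?case
  \<comment> \<open>Over an infinite vertex set the sum takes its default value 0, which lies in the
    carrier.\<close>
  proof (cases "finite (pverts G)")
    case True
    then show ?thesis
      using f finsum_closed[of ?f "pverts G"] finsum_free_algebra[of "pverts G" ?f "parcs G"]
      by (simp add: Pi_def del: free_algebra_simps)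
  qed simp
qed

text \<open>Both sides obey the same recursion in \<open>k\<close>, because
  \<open>order_proj\<close> is a ring homomorphism and sends each variable to the corresponding
  entry of \<open>Z\<close>.\<close>

lemma matrix_power_walk_matrix:
  assumes "finite (pverts G)"
  shows "matrix_power (order_quotient G r) (pverts G) (walk_matrix G r) k u v
    = order_proj G r (walk_sum G k u v)"
proof -
  interpret h: ring_hom_ring "free_algebra (parcs G)" "order_quotient G r" "order_proj G r"
    by (rule order_proj_hom)
  let ?x = "\<lambda>w v. if (w, v) \<in> parcs G then Poly_Mapping.single [(w, v)] (1::rat) else 0"
  have x: "?x w v \<in> carrier (free_algebra (parcs G))" for w v
    by simp
  have Z: "walk_matrix G r w v = order_proj G r (?x w v)" for w v
    using h.hom_zero by (simp add: walk_matrix_def order_quotient_monomial_eq_proj)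
  have prod: "walk_sum G k u w * ?x w v \<in> carrier (free_algebra (parcs G))" for k u w v
    using h.R.m_closed[OF walk_sum_carrier x] by simp
  show ?thesis
  proof (induction k arbitrary: v)
    case 0
    then show ?case
      using h.hom_zero h.hom_one by (simp add: matrix_one_def)
  next
    case (Suc k)
    have "order_proj G r (walk_sum G (Suc k) u v)
        = order_proj G r (\<Oplus>\<^bsub>free_algebra (parcs G)\<^esub>w\<in>pverts G. walk_sum G k u w * ?x w v)"
      using prod assms by (subst finsum_free_algebra) (auto simp del: free_algebra_simps(1))
    also have "\<dots> = (\<Oplus>\<^bsub>order_quotient G r\<^esub>w\<in>pverts G. order_proj G r (walk_sum G k u w * ?x w v))"
      using prod by (subst h.hom_finsum) (auto simp: comp_def simp del: free_algebra_simps(1))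
    also have "(\<lambda>w. order_proj G r (walk_sum G k u w * ?x w v))
        = (\<lambda>w. order_proj G r (walk_sum G k u w) \<otimes>\<^bsub>order_quotient G r\<^esub> walk_matrix G r w v)"
      unfolding Z using h.hom_mult[OF walk_sum_carrier x] by simp
    finally show ?case
      by (simp add: matrix_times_def Suc.IH)
  qed
qed

text \<open>The final letter of the word of a walk records its penultimate vertex, so only the
  summand \<open>w\<close> equal to that vertex contributes. Removing the last vertex gives the
  induction.\<close>

lemma lookup_walk_sum:
  assumes "finite (pverts G)" "vwalk p (with_proj G)"
  shows "Poly_Mapping.lookup (walk_sum G (vwalk_length p) (hd p) (last p)) (vwalk_arcs p) = 1"
  using assms(2)
proof (induction p rule: rev_induct)
  case Nil
  then show ?case by (simp add: vwalk_def)
next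
  case (snoc v p)
  show ?case
  proof (cases "p = []")
    case True
    then show ?thesis by (simp add: lookup_one zero_list_def)
  next
    case False
    have arcs: "vwalk_arcs (p @ [v]) = vwalk_arcs p @ [(last p, v)]"
      using False by (simp add: vwalk_arcs_append)
    have p: "vwalk p (with_proj G)" "(last p, v) \<in> parcs G" "last p \<in> pverts G"
      using snoc.prems False arcs by (auto simp: vwalk_def)
    have len: "vwalk_length (p @ [v]) = Suc (vwalk_length p)"
      using False by (cases p) auto
    have "Poly_Mapping.lookup (walk_sum G (vwalk_length (p @ [v])) (hd p) v) (vwalk_arcs p @ [(last p, v)])
      = (\<Sum>w\<in>pverts G. if w = last p
           then Poly_Mapping.lookup (walk_sum G (vwalk_length p) (hd p) w) (vwalk_arcs p) else 0)"
      unfolding len walk_sum.simps lookup_sum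
      by (rule sum.cong) (use p(2) in \<open>auto simp: lookup_times_single_append\<close>)
    also have "\<dots> = 1"
      using p assms(1) snoc.IH by simp
    finally show ?thesis
      using False by (simp add: arcs)
  qed
qed

text \<open>Coefficients of reduced words survive in the quotient, and the words of \<open>p\<close>
  and \<open>q\<close> both have coefficient 1 in the entry. So the entry is nonzero, and the one
  word of its monomial equals both.\<close>

lemma single_monomial_unique_reduced_walk:
  assumes fin: "finite (pverts G)"
    and entry: "single_monomial G r (matrix_power (order_quotient G r) (pverts G) (walk_matrix G r) k u v)
      \<or> matrix_power (order_quotient G r) (pverts G) (walk_matrix G r) k u v = \<zero>\<^bsub>order_quotient G r\<^esub>"
    and p: "vwalk p (with_proj G)" "vwalk_length p = k" "hd p = u" "last p = v"
      "successively (reduced_step G r) (vwalk_arcs p)"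
    and q: "vwalk q (with_proj G)" "vwalk_length q = k" "hd q = u" "last q = v"
      "successively (reduced_step G r) (vwalk_arcs q)"
  shows "vwalk_arcs p = vwalk_arcs q"
proof -
  interpret h: ring_hom_ring "free_algebra (parcs G)" "order_quotient G r" "order_proj G r"
    by (rule order_proj_hom)
  have entry': "single_monomial G r (order_proj G r (walk_sum G k u v))
      \<or> order_proj G r (walk_sum G k u v) = order_proj G r 0"
    using entry h.hom_zero unfolding matrix_power_walk_matrix[OF fin] by simp
  have one: "Poly_Mapping.lookup (walk_sum G k u v) (vwalk_arcs p) = 1"
    "Poly_Mapping.lookup (walk_sum G k u v) (vwalk_arcs q) = 1"
    using lookup_walk_sum[OF fin p(1)] lookup_walk_sum[OF fin q(1)] p q by auto
  have "order_proj G r (walk_sum G k u v) \<noteq> order_proj G r 0"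
    using order_proj_eqD[OF walk_sum_carrier _ _ p(5)] one(1) by fastforce
  then obtain c where c: "vwalk c (with_proj G)"
    "order_proj G r (walk_sum G k u v) = order_proj G r (Poly_Mapping.single (vwalk_arcs c) 1)"
    using entry' unfolding single_monomial_def order_quotient_monomial_eq_proj by blast
  have "Poly_Mapping.single (vwalk_arcs c) 1 \<in> carrier (free_algebra (parcs G))"
    using c(1) by (auto simp: vwalk_def)
  note eq = order_proj_eqD[OF walk_sum_carrier this c(2)]
  show ?thesis
    using eq[OF p(5)] eq[OF q(5)] one by (auto simp: lookup_single when_def split: if_splits)
qed

section \<open>Lexicographically least walks\<close>

text \<open>Equal heads settle the one-vertex walks, all of which have the empty arc word.\<close>

lemma vwalk_arcs_eq_hd_imp_eq:
  assumes "vwalk_arcs p = vwalk_arcs q" "length p = length q" "hd p = hd q"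
  shows "p = q"
  using assms
proof (induction p arbitrary: q rule: vwalk_arcs.induct)
  case (2 x)
  then show ?case by (cases q) auto
next
  case (3 x y p)
  then obtain a b q' where q: "q = a # b # q'"
    by (metis Suc_length_conv)
  then show ?case
    using 3(1)[of "b # q'"] 3(2-) by auto
qed simp

lemma length_vwalk_arcs: "length (vwalk_arcs p) = length p - 1"
  using vwalk_length_simp[of p] unfolding vwalk_length_def .

lemma nth_vwalk_arcs:
  "Suc i < length p \<Longrightarrow> vwalk_arcs p ! i = (p ! i, p ! Suc i)"
  by (induction p arbitrary: i rule: vwalk_arcs.induct) (auto simp: nth_Cons split: nat.splits)

lemma vwalk_iff_nth:
  "vwalk p (with_proj G) \<longleftrightarrow> p \<noteq> [] \<and> set p \<subseteq> pverts G \<and>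
     (\<forall>i. Suc i < length p \<longrightarrow> (p ! i, p ! Suc i) \<in> parcs G)"
proof -
  have len: "i < length (vwalk_arcs p) \<longleftrightarrow> Suc i < length p" for i
    by (auto simp: length_vwalk_arcs)
  show ?thesis
    unfolding vwalk_def with_proj_simps set_conv_nth[of "vwalk_arcs p"] len
    by (auto simp: nth_vwalk_arcs)
qed

text \<open>This is the conclusion that \<open>vertex_shelling_order\<close> demands of the walk
  with the larger second vertex.\<close>

definition improvable :: "'v pair_pre_digraph \<Rightarrow> 'v rel \<Rightarrow> 'v list \<Rightarrow> bool" where
  "improvable G r p \<longleftrightarrow> (\<exists>j\<in>{1..vwalk_length p - 1}. \<exists>w\<in>pverts G. (w, p ! j) \<in> r - Id \<and>
     (p ! (j - 1), w) \<in> parcs G \<and> (w, p ! (j + 1)) \<in> parcs G)"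

text \<open>Arcs \<open>i\<close> and \<open>Suc i\<close> of the word meet at vertex
  \<open>Suc i\<close> of the walk, which plays the role of \<open>j\<close>. Well-formedness puts
  the vertex \<open>w\<close> of \<open>reduced_step\<close> into \<open>pverts G\<close>.\<close>

lemma not_improvable_imp_reduced:
  assumes "pair_wf_digraph G" "\<not> improvable G r p"
  shows "successively (reduced_step G r) (vwalk_arcs p)"
  unfolding successively_conv_nth
proof (intro allI impI)
  interpret pair_wf_digraph G by fact
  fix i assume "Suc i < length (vwalk_arcs p)"
  then have i: "Suc (Suc i) < length p"
    by (simp add: length_vwalk_arcs)
  then have "Suc i \<in> {1..vwalk_length p - 1}"
    by simp
  then have "\<forall>w\<in>pverts G. \<not> ((w, p ! Suc i) \<in> r - Id \<and> (p ! i, w) \<in> parcs G \<and> (w, p ! Suc (Suc i)) \<in> parcs G)"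
    using assms(2) unfolding improvable_def by fastforce
  then show "reduced_step G r (vwalk_arcs p ! i) (vwalk_arcs p ! Suc i)"
    using i in_arcsD1 in_arcsD2 by (fastforce simp: nth_vwalk_arcs reduced_step_def)
qed

text \<open>Exchanging the vertex at \<open>j\<close> for \<open>w\<close> changes one interior
  position, and lowers it.\<close>

lemma improvable_imp_lex_smaller:
  assumes p: "vwalk p (with_proj G)" and "improvable G r p"
  obtains q where "vwalk q (with_proj G)" "length q = length p" "hd q = hd p" "last q = last p"
    "(q, p) \<in> lex (r - Id)"
proof -
  obtain j w where j: "1 \<le> j" "j \<le> vwalk_length p - 1" "w \<in> pverts G" "(w, p ! j) \<in> r - Id"
    "(p ! (j - 1), w) \<in> parcs G" "(w, p ! (j + 1)) \<in> parcs G"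
    using assms(2) unfolding improvable_def by auto
  \<comment> \<open>As \<open>1 \<le> j\<close>, the subtraction in the bound on \<open>j\<close> is
    not truncated, so \<open>j\<close> is interior.\<close>
  then have jl: "Suc j < length p" by auto
  show ?thesis
  proof (rule that[of "p[j := w]"])
    show "vwalk (p[j := w]) (with_proj G)"
      unfolding vwalk_iff_nth
    proof (intro conjI allI impI)
      show "p[j := w] \<noteq> []" using jl by auto
      show "set (p[j := w]) \<subseteq> pverts G"
        using set_update_subset_insert[of p j w] j(3) p by (auto simp: vwalk_iff_nth)
      show "(p[j := w] ! i, p[j := w] ! Suc i) \<in> parcs G" if "Suc i < length (p[j := w])" for i
        using that p j jl by (cases "i = j"; cases "Suc i = j") (auto simp: vwalk_iff_nth)
    qed
    show "hd (p[j := w]) = hd p"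
      using j(1) jl by (cases p; cases j) simp_all
    have "p \<noteq> []" "j \<noteq> length p - 1" using jl by auto
    then show "last (p[j := w]) = last p"
      by (simp add: last_list_update)
    show "(p[j := w], p) \<in> lex (r - Id)"
      unfolding lex_conv using jl j(4) upd_conv_take_nth_drop[of j p w] id_take_nth_drop[of j p]
      by fastforce
  qed simp
qed

theorem theorem6p7:
  fixes G :: "'v pair_pre_digraph" and r :: "'v rel" and n :: nat
  assumes "pair_fin_digraph G"
    and "card (pverts G) = n"
    and "linear_order_on (pverts G) r"
    and "\<And>k u v. k \<ge> 1 \<Longrightarrow> u \<in> pverts G \<Longrightarrow> v \<in> pverts G \<Longrightarrow>
           single_monomial G r (matrix_power (order_quotient G r) (pverts G) (walk_matrix G r) k u v)
           \<or> matrix_power (order_quotient G r) (pverts G) (walk_matrix G r) k u v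
               = \<zero>\<^bsub>order_quotient G r\<^esub>"
  shows "vertex_shelling_order G r"
proof -
  interpret pair_fin_digraph G by fact
  have partial: "partial_order_on (pverts G) r"
    using assms(3) by (simp add: linear_order_on_def)
  have r: "trans r" "antisym r" "r \<subseteq> pverts G \<times> pverts G"
    using partial unfolding partial_order_on_def preorder_on_def refl_on_def by auto
  have trans: "trans (lex (r - Id))"
    by (intro lex_transI trans_diff_Id r)
  have "finite r"
    using r(3) by (rule finite_subset) simp
  \<comment> \<open>The strict order is well-founded, being finite and acyclic; \<open>lex\<close>
    compares only lists of equal length and inherits this.\<close>
  then have wf: "wf (lex (r - Id))"
    using partial_order_on_acyclic[OF partial] by (intro wf_lex finite_acyclic_wf) auto
  have "improvable G r p"
    if p: "vwalk p (with_proj G)" and q: "vwalk q (with_proj G)"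
      and len: "vwalk_length p = k" "vwalk_length q = k" "k \<ge> 1"
      and ends: "hd p = hd q" "last p = last q" and less: "(q ! 1, p ! 1) \<in> r - Id" for p q k
  proof (rule ccontr)
    assume "\<not> improvable G r p"
    then have red_p: "successively (reduced_step G r) (vwalk_arcs p)"
      by (rule not_improvable_imp_reduced[OF pair_wf_digraph_axioms])
    \<comment> \<open>A minimal element of \<open>S\<close> will be a second reduced walk with the
      ends and length of \<open>p\<close>, strictly below \<open>p\<close>, against
      uniqueness.\<close>
    define S where "S = {s. vwalk s (with_proj G) \<and> length s = length p \<and> hd s = hd p \<and>
      last s = last p \<and> (s, p) \<in> lex (r - Id)}"
    have lens: "length q = length p" "Suc 0 < length p"
      using len by auto
    \<comment> \<open>The first vertices agree, so position 1 decides.\<close>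
    have "(q, p) \<in> lex (r - Id)"
    proof -
      obtain x y p' where "p = x # y # p'"
        using lens(2) by (metis Suc_lessD length_0_conv less_irrefl neq_Nil_conv length_Cons)
      moreover obtain x' y' q' where "q = x' # y' # q'"
        using lens by (metis Suc_lessD length_0_conv less_irrefl neq_Nil_conv length_Cons)
      ultimately show ?thesis
        using lens ends(1) less by simp
    qed
    then have "q \<in> S"
      using q lens ends by (simp add: S_def)
    then obtain s where s: "s \<in> S" "\<And>t. (t, s) \<in> lex (r - Id) \<Longrightarrow> t \<notin> S"
      using wfE_min[OF wf] by blast
    \<comment> \<open>An improvement of \<open>s\<close> would be below \<open>p\<close> by
      transitivity, hence in \<open>S\<close>, against minimality.\<close>
    have "\<not> improvable G r s"
    proof
      assume "improvable G r s"
      then obtain t where t: "vwalk t (with_proj G)" "length t = length s" "hd t = hd s"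
        "last t = last s" "(t, s) \<in> lex (r - Id)"
        using improvable_imp_lex_smaller[of s G r] s(1) unfolding S_def by blast
      then have "t \<in> S"
        using s(1) transD[OF trans] unfolding S_def by auto
      with s(2) t(5) show False by blast
    qed
    then have red_s: "successively (reduced_step G r) (vwalk_arcs s)"
      by (rule not_improvable_imp_reduced[OF pair_wf_digraph_axioms])
    have "hd p \<in> pverts G" "last p \<in> pverts G"
      using p by (auto simp: vwalk_def)
    then have "vwalk_arcs p = vwalk_arcs s"
      using single_monomial_unique_reduced_walk[OF _ assms(4)[OF len(3)] p len(1) refl refl red_p _ _ _ _ red_s]
        s(1) len(1) unfolding S_def by simp
    then have "p = s"
      by (rule vwalk_arcs_eq_hd_imp_eq) (use s(1) in \<open>auto simp: S_def\<close>)
    then show False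
      using s(1) wf_not_refl[OF wf, of p] unfolding S_def by simp
  qed
  then show ?thesis
    using assms(3) unfolding vertex_shelling_order_def improvable_def by blast
qed

end
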